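(* Let $q=p^m=2d-1$ be a power of a prime $p$ with $q\equiv 3\pmod 4$, and let $\psi$ be a nontrivial additive character of $\mathbb{F}_q$. Then there exists a $(2d-1,d)$ equiangular tight frame with Gram matrix $$G=\frac{1}{2d}\left(J+qI+i\sqrt{q}\,A\right),$$ where $J$ is the $q\times q$ all-ones matrix, $I$ is the $q\times q$ identity matrix, and $A$ is the adjacency matrix of the Paley tournament on $\mathbb{F}_q$. This frame is given by the canonical tight frame associated with the set of vectors formed by removing the first element from Zauner's $(2d,d)$ frame built from $\psi$. That is, if $f_1,\dots,f_q\in\mathbb{C}^d$ are the columns of the matrix $T$ defined in the context other than its first column, and $S=\sum_{j=1}^{q} f_jf_j^*$ is their frame operator, then the frame consists of the normalized vectors $\phi_k=\sqrt{q/d}\;S^{-1/2}f_k$, $k=1,\dots,q$, and $G_{jk}=\phi_j^*\phi_k$.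
   Context: An $(n,d)$ equiangular tight frame is a set of $n$ normalized vectors $\phi_1,\dots,\phi_n\in\mathbb{C}^d$ such that $|\langle\phi_j,\phi_k\rangle|^2=\frac{n-d}{d(n-1)}$ for all $j\neq k$. Let $a_1,\dots,a_q$ be the elements of $\mathbb{F}_q$ and $b_1,\dots,b_{(q-1)/2}$ the nonzero squares in $\mathbb{F}_q$. The quadratic character $\chi$ of $\mathbb{F}_q$ is given by $\chi(0)=0$, $\chi(a)=1$ if $a$ is a nonzero square, and $\chi(a)=-1$ otherwise. The adjacency matrix of the Paley tournament is the $q\times q$ matrix with entries $A_{jk}=\chi(a_j-a_k)$. Zauner's $(2d,d)$ frame built from a nontrivial additive character $\psi$ of $\mathbb{F}_q$ consists of the $q+1=2d$ columns of the $\frac{q+1}{2}\times(q+1)$ matrix $$T=\frac{1}{\sqrt{q}}\begin{pmatrix} \sqrt{q} & 1& 1 &\cdots &1\\ 0 & \sqrt{2}\,\psi(b_1a_1) & \sqrt{2}\,\psi(b_1a_2) & \cdots & \sqrt{2}\,\psi(b_1a_q)\\ \vdots & \vdots & \vdots &\ddots &\vdots\\ 0 & \sqrt{2}\,\psi(b_{\frac{q-1}{2}}a_1) & \sqrt{2}\,\psi(b_{\frac{q-1}{2}}a_2) & \cdots & \sqrt{2}\,\psi(b_{\frac{q-1}{2}}a_q) \end{pmatrix}.$$ After removing the first column, $f_k$ denotes the column indexed by $a_k$. The canonical tight frame associated with a frame $\{f_k\}$ is $\{S^{-1/2}f_k\}$, where $S=\sum_j f_jf_j^*$ is the frame operator and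 $S^{-1/2}$ is the inverse of its positive square root.
   Formalization: The Gram matrix is G only if the Gauss sum of ψ is −i√q; if it is i√q, A becomes −A. As stated it fails for q=3, ψ(x)=exp(2πix/3). Proved: ψ or its conjugate gives exactly G, and ψ always gives an equiangular tight frame with Gram matrix G or G with −A. *)

theory Defs
  imports
    "HOL-Computational_Algebra.Primes"
    "Jordan_Normal_Form.Schur_Decomposition"
    "Jordan_Normal_Form.Gauss_Jordan_Elimination"
begin

text \<open>The inner product \<open>u\<^sup>* v\<close>, conjugate-linear in the first argument, is \<open>v \<bullet>c u\<close>.
  All families of vectors and all enumerations are indexed from 0.\<close>

definition gram_mat :: "nat \<Rightarrow> (nat \<Rightarrow> complex vec) \<Rightarrow> complex mat" where
  "gram_mat n \<phi> = mat n n (\<lambda>(j, k). \<phi> k \<bullet>c \<phi> j)"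

definition equiangular_tight_frame :: "nat \<Rightarrow> nat \<Rightarrow> (nat \<Rightarrow> complex vec) \<Rightarrow> bool" where
  "equiangular_tight_frame n d \<phi> \<longleftrightarrow>
     (\<forall>k<n. \<phi> k \<in> carrier_vec d \<and> \<phi> k \<bullet>c \<phi> k = 1) \<and>
     (\<forall>j<n. \<forall>k<n. j \<noteq> k \<longrightarrow>
        (cmod (\<phi> k \<bullet>c \<phi> j))\<^sup>2 = (real n - real d) / (real d * (real n - 1)))"

definition frame_operator :: "nat \<Rightarrow> nat \<Rightarrow> (nat \<Rightarrow> complex vec) \<Rightarrow> complex mat" where
  "frame_operator n d f = mat d d (\<lambda>(r, s). \<Sum>j<n. f j $ r * cnj (f j $ s))"

definition positive_semidefinite :: "complex mat \<Rightarrow> bool" where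
  "positive_semidefinite A \<longleftrightarrow>
     square_mat A \<and> mat_adjoint A = A \<and>
     (\<forall>v \<in> carrier_vec (dim_row A). 0 \<le> Re ((A *\<^sub>v v) \<bullet>c v))"

text \<open>Only meaningful for positive semidefinite \<open>S\<close>, which has exactly one positive
  semidefinite square root; its inverse exists when \<open>S\<close> is moreover invertible.\<close>

definition positive_sqrt :: "complex mat \<Rightarrow> complex mat" where
  "positive_sqrt S = (THE R. R \<in> carrier_mat (dim_row S) (dim_row S) \<and>
     positive_semidefinite R \<and> R * R = S)"

definition inv_positive_sqrt :: "complex mat \<Rightarrow> complex mat" where
  "inv_positive_sqrt S = the (mat_inverse (positive_sqrt S))"

definition canonical_tight_frame ::
    "nat \<Rightarrow> nat \<Rightarrow> (nat \<Rightarrow> complex vec) \<Rightarrow> nat \<Rightarrow> complex vec" where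
  "canonical_tight_frame n d f k = inv_positive_sqrt (frame_operator n d f) *\<^sub>v f k"

definition quadratic_character :: "'a::field \<Rightarrow> int" where
  "quadratic_character x = (if x = 0 then 0 else if \<exists>y. x = y\<^sup>2 then 1 else - 1)"

definition nonzero_squares :: "'a::field set" where
  "nonzero_squares = {x. x \<noteq> 0 \<and> (\<exists>y. x = y\<^sup>2)}"

definition paley_tournament_mat :: "nat \<Rightarrow> (nat \<Rightarrow> 'a::field) \<Rightarrow> complex mat" where
  "paley_tournament_mat q a = mat q q (\<lambda>(j, k). of_int (quadratic_character (a j - a k)))"

definition additive_character :: "('a::field \<Rightarrow> complex) \<Rightarrow> bool" where
  "additive_character \<psi> \<longleftrightarrow> (\<forall>x. \<psi> x \<noteq> 0) \<and> (\<forall>x y. \<psi> (x + y) = \<psi> x * \<psi> y)"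

definition nontrivial_additive_character :: "('a::field \<Rightarrow> complex) \<Rightarrow> bool" where
  "nontrivial_additive_character \<psi> \<longleftrightarrow> additive_character \<psi> \<and> (\<exists>x. \<psi> x \<noteq> 1)"

text \<open>For \<open>q \<equiv> 3 (mod 4)\<close> this is \<open>\<plusminus>\<i>\<surd>q\<close>, with the sign depending on \<open>\<psi>\<close>. Since
  \<open>f\<^sub>j\<^sup>* f\<^sub>k = - \<chi>(a\<^sub>j - a\<^sub>k) g(\<psi>) / q\<close> for \<open>j \<noteq> k\<close>, this sign decides whether the Gram matrix
  involves the tournament or its reversal; \<open>\<psi>\<close> and its conjugate give opposite orientations.\<close>

definition quadratic_gauss_sum :: "('a::{field,finite} \<Rightarrow> complex) \<Rightarrow> complex" where
  "quadratic_gauss_sum \<psi> = (\<Sum>x\<in>UNIV. of_int (quadratic_character x) * \<psi> x)"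

definition zauner_mat ::
    "nat \<Rightarrow> ('a::field \<Rightarrow> complex) \<Rightarrow> (nat \<Rightarrow> 'a) \<Rightarrow> (nat \<Rightarrow> 'a) \<Rightarrow> complex mat" where
  "zauner_mat q \<psi> a b = complex_of_real (1 / sqrt (real q)) \<cdot>\<^sub>m
     mat ((q + 1) div 2) (q + 1) (\<lambda>(r, c).
       if c = 0 then (if r = 0 then complex_of_real (sqrt (real q)) else 0)
       else if r = 0 then 1
       else complex_of_real (sqrt 2) * \<psi> (b (r - 1) * a (c - 1)))"

definition truncated_zauner ::
    "nat \<Rightarrow> ('a::field \<Rightarrow> complex) \<Rightarrow> (nat \<Rightarrow> 'a) \<Rightarrow> (nat \<Rightarrow> 'a) \<Rightarrow> nat \<Rightarrow> complex vec" where
  "truncated_zauner q \<psi> a b k = col (zauner_mat q \<psi> a b) (k + 1)"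

definition normalized_canonical_zauner ::
    "nat \<Rightarrow> nat \<Rightarrow> ('a::field \<Rightarrow> complex) \<Rightarrow> (nat \<Rightarrow> 'a) \<Rightarrow> (nat \<Rightarrow> 'a) \<Rightarrow> nat \<Rightarrow> complex vec" where
  "normalized_canonical_zauner q d \<psi> a b k =
     complex_of_real (sqrt (real q / real d)) \<cdot>\<^sub>v
       canonical_tight_frame q d (truncated_zauner q \<psi> a b) k"

definition paley_gram :: "nat \<Rightarrow> nat \<Rightarrow> complex mat \<Rightarrow> complex mat" where
  "paley_gram q d A = (1 / (2 * of_nat d)) \<cdot>\<^sub>m
     (mat q q (\<lambda>_. 1) + of_nat q \<cdot>\<^sub>m 1\<^sub>m q + (\<i> * complex_of_real (sqrt (real q))) \<cdot>\<^sub>m A)"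

end

theory Submission
  imports Defs "HOL-Library.Cardinality"
begin

text \<open>The frame operator of the truncated frame is \<open>S = diag(1, 2, \<dots>, 2)\<close> by orthogonality of
  additive characters, so \<open>\<phi>\<^sub>k\<close> has entries \<open>1 / \<surd>d\<close> and \<open>\<psi>(b\<^sub>r a\<^sub>k) / \<surd>d\<close>. Hence
  \<open>d \<phi>\<^sub>j\<^sup>* \<phi>\<^sub>k = 1 + P(a\<^sub>k - a\<^sub>j)\<close>, where \<open>P(x)\<close> is the sum of \<open>\<psi>(s x)\<close> over the nonzero squares \<open>s\<close>.
  As \<open>q \<equiv> 3 (mod 4)\<close>, \<open>-1\<close> is not a square, so \<open>P(x)\<close> is \<open>P(1)\<close> or its conjugate for \<open>x \<noteq> 0\<close>;
  since \<open>P(1)\<close> and its conjugate add up to \<open>-1\<close> and differ by the Gauss sum \<open>g\<close>,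
  \<open>2 P(x) = \<chi>(x) g - 1\<close>. Parseval's identity for \<open>P\<close> then forces \<open>g\<^sup>2 = -q\<close>.\<close>

section \<open>Squares and additive characters of finite fields\<close>

text \<open>The pairs \<open>{x, f x}\<close> partition \<open>A\<close>; the induction removes one
  pair at a time.\<close>

lemma even_card_involution:
  assumes "finite A" and "\<And>x. x \<in> A \<Longrightarrow> f x \<in> A \<and> f (f x) = x \<and> f x \<noteq> x"
  shows "even (card A)"
  using assms
proof (induction A rule: finite_psubset_induct)
  case (psubset A)
  show ?case
  proof (cases "A = {}")
    case False
    then obtain x where x: "x \<in> A" by blast
    have "even (card (A - {x, f x}))"
    proof (rule psubset.IH)
      show "A - {x, f x} \<subset> A" using x by blast
      show "f y \<in> A - {x, f x} \<and> f (f y) = y \<and> f y \<noteq> y" if "y \<in> A - {x, f x}" for y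
        using psubset.prems[of x] psubset.prems[of y] x that by (metis Diff_iff insert_iff empty_iff)
    qed
    moreover have "card A = card (A - {x, f x}) + card {x, f x}"
      using psubset.hyps psubset.prems[OF x] x
      by (metis Diff_subset card_Diff_subset card_mono empty_subsetI finite.emptyI finite.insertI insert_subset le_add_diff_inverse2)
    ultimately show ?thesis using psubset.prems[OF x] by auto
  qed simp
qed

text \<open>If \<open>- x = x\<close>, then translation by \<open>x\<close> is a fixed-point-free
  involution of the whole field, which would make its cardinality even.\<close>

lemma minus_neq_self_if_odd_card:
  fixes x :: "'a::{field,finite}"
  assumes "odd CARD('a)" and "x \<noteq> 0"
  shows "- x \<noteq> x"
proof
  assume eq: "- x = x"
  then have "x + x = 0" by (metis add.right_inverse)
  then have "y + x + x = y" for y by (simp add: add.assoc)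
  then have "even CARD('a)"
    using assms(2) by (intro even_card_involution[where f = "\<lambda>y. y + x"]) auto
  with assms(1) show False by simp
qed

text \<open>Squaring is two-to-one on the nonzero elements: the fibre over \<open>z\<^sup>2\<close>
  is \<open>{z, - z}\<close>.\<close>

lemma card_nonzero_squares:
  assumes "odd CARD('a::{field,finite})"
  shows "2 * card (nonzero_squares :: 'a set) = CARD('a) - 1"
proof -
  have fib: "card {y \<in> UNIV - {0}. y\<^sup>2 = s} = 2" if "s \<in> nonzero_squares" for s :: 'a
  proof -
    from that obtain z where z: "s = z\<^sup>2" "z \<noteq> 0"
      by (auto simp: nonzero_squares_def)
    then have "{y \<in> UNIV - {0}. y\<^sup>2 = s} = {z, - z}"
      by (auto simp: power2_eq_iff)
    with minus_neq_self_if_odd_card[OF assms z(2)] show ?thesis by auto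
  qed
  have "card (UNIV - {0 :: 'a}) = (\<Sum>s\<in>nonzero_squares. card {y \<in> UNIV - {0 :: 'a}. y\<^sup>2 = s})"
    unfolding card_eq_sum
    by (rule sum.group[symmetric]) (auto simp: nonzero_squares_def)
  also have "\<dots> = 2 * card (nonzero_squares :: 'a set)"
    by (subst sum.cong[OF refl fib]) auto
  finally show ?thesis by simp
qed

lemma nonzero_squares_mult:
  "x \<in> nonzero_squares \<Longrightarrow> y \<in> nonzero_squares \<Longrightarrow> x * y \<in> nonzero_squares"
  unfolding nonzero_squares_def by (auto simp: power_mult_distrib[symmetric])

text \<open>If \<open>- 1\<close> were a square, negation would act on the nonzero squares without
  fixed points, although their number (q - 1) / 2 is odd.\<close>

lemma minus_one_not_square:
  assumes "CARD('a::{field,finite}) mod 4 = 3"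
  shows "- 1 \<notin> (nonzero_squares :: 'a set)"
proof
  assume neg: "- 1 \<in> (nonzero_squares :: 'a set)"
  have odd: "odd CARD('a)" using assms by presburger
  have "even (card (nonzero_squares :: 'a set))"
  proof (rule even_card_involution[where f = uminus])
    show "- x \<in> nonzero_squares \<and> - (- x) = x \<and> - x \<noteq> x" if "x \<in> nonzero_squares" for x :: 'a
      using nonzero_squares_mult[OF neg that] minus_neq_self_if_odd_card[OF odd, of x] that
      by (auto simp: nonzero_squares_def)
  qed simp
  moreover have "2 * card (nonzero_squares :: 'a set) = CARD('a) - 1"
    by (rule card_nonzero_squares[OF odd])
  ultimately show False using assms by presburger
qed

text \<open>The nonzero squares and their negatives are disjoint sets of (q - 1) / 2 elements each,
  so by counting they exhaust the nonzero elements.\<close>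

lemma minus_square_iff:
  fixes x :: "'a::{field,finite}"
  assumes "CARD('a) mod 4 = 3" and "x \<noteq> 0"
  shows "- x \<in> nonzero_squares \<longleftrightarrow> x \<notin> nonzero_squares"
proof -
  let ?S = "nonzero_squares :: 'a set"
  have odd: "odd CARD('a)" using assms(1) by presburger
  have disj: "?S \<inter> uminus ` ?S = {}"
  proof (rule ccontr)
    assume "?S \<inter> uminus ` ?S \<noteq> {}"
    then obtain y where y: "y \<in> ?S" "- y \<in> ?S" by auto
    then obtain u v where "y = u\<^sup>2" "- y = v\<^sup>2" "y \<noteq> 0" by (auto simp: nonzero_squares_def)
    then have "- 1 = (v / u)\<^sup>2" by (simp add: power_divide field_simps)
    with minus_one_not_square[OF assms(1)] show False by (auto simp: nonzero_squares_def)
  qed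
  have "?S \<union> uminus ` ?S = UNIV - {0}"
  proof (rule card_subset_eq)
    have "card (?S \<union> uminus ` ?S) = 2 * card ?S"
      using disj by (simp add: card_Un_disjoint card_image)
    with card_nonzero_squares[OF odd] show "card (?S \<union> uminus ` ?S) = card (UNIV - {0 :: 'a})"
      by simp
  qed (auto simp: nonzero_squares_def)
  with assms(2) have "x \<in> ?S \<union> uminus ` ?S" by blast
  moreover have "x \<in> uminus ` ?S \<longleftrightarrow> - x \<in> ?S"
    using image_iff[of x uminus ?S] by (metis minus_minus)
  ultimately show ?thesis using disj by blast
qed

lemma quadratic_character_eq:
  "quadratic_character x = (if x = 0 then 0 else if x \<in> nonzero_squares then 1 else - 1)"
  by (simp add: quadratic_character_def nonzero_squares_def)

lemma quadratic_character_minus: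
  fixes x :: "'a::{field,finite}"
  assumes "CARD('a) mod 4 = 3"
  shows "quadratic_character (- x) = - quadratic_character x"
  using minus_square_iff[OF assms, of x] by (auto simp: quadratic_character_eq)

section \<open>Additive characters: unimodularity and orthogonality\<close>

lemma additive_character_zero: "additive_character \<psi> \<Longrightarrow> \<psi> 0 = 1"
  unfolding additive_character_def by (metis add.right_neutral mult_cancel_left2)

text \<open>Translation by \<open>x\<close> permutes the field and multiplies the product of all
  values by \<open>\<psi> x ^ CARD('a)\<close>. As that product is nonzero, \<open>\<psi> x\<close>
  is a root of unity.\<close>

lemma cmod_additive_character:
  fixes \<psi> :: "'a::{field,finite} \<Rightarrow> complex"
  assumes "additive_character \<psi>"
  shows "cmod (\<psi> x) = 1"
proof -
  have "(\<Prod>y\<in>UNIV. \<psi> y) = (\<Prod>y\<in>UNIV. \<psi> (y + x))"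
    by (rule prod.reindex_bij_betw[OF bij_plus_right, symmetric])
  also have "\<dots> = \<psi> x ^ CARD('a) * (\<Prod>y\<in>UNIV. \<psi> y)"
    using assms by (simp add: additive_character_def prod.distrib)
  finally have "\<psi> x ^ CARD('a) = 1"
    using assms by (simp add: additive_character_def)
  then show ?thesis
    using power_eq_1_iff by fastforce
qed

lemma additive_character_minus:
  fixes \<psi> :: "'a::{field,finite} \<Rightarrow> complex"
  assumes "additive_character \<psi>"
  shows "\<psi> (- x) = cnj (\<psi> x)"
proof -
  have "\<psi> x * \<psi> (- x) = 1"
    using assms additive_character_zero[OF assms] unfolding additive_character_def
    by (metis add.right_inverse)
  moreover have "\<psi> x * cnj (\<psi> x) = 1"
    using cmod_additive_character[OF assms, of x] by (simp add: complex_norm_square[symmetric])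
  ultimately show ?thesis
    by (metis mult_cancel_left mult_zero_left zero_neq_one)
qed

lemma additive_character_mult_cnj:
  fixes \<psi> :: "'a::{field,finite} \<Rightarrow> complex"
  assumes "additive_character \<psi>"
  shows "\<psi> x * cnj (\<psi> y) = \<psi> (x - y)"
  using assms unfolding additive_character_minus[OF assms, symmetric] additive_character_def
  by (metis diff_conv_add_uminus)

text \<open>A shift by some \<open>u\<close> with \<open>\<psi> u \<noteq> 1\<close> multiplies the
  full sum by \<open>\<psi> u\<close>, so the sum vanishes; for \<open>c \<noteq> 0\<close>
  multiplication by \<open>c\<close> merely permutes the summands.\<close>

lemma sum_additive_character:
  fixes \<psi> :: "'a::{field,finite} \<Rightarrow> complex"
  assumes "nontrivial_additive_character \<psi>"
  shows "(\<Sum>x\<in>UNIV. \<psi> (c * x)) = (if c = 0 then of_nat CARD('a) else 0)"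
proof -
  have add: "additive_character \<psi>"
    and "\<exists>x. \<psi> x \<noteq> 1"
    using assms by (auto simp: nontrivial_additive_character_def)
  then obtain u where u: "\<psi> u \<noteq> 1" by blast
  have "(\<Sum>x\<in>UNIV. \<psi> x) = (\<Sum>x\<in>UNIV. \<psi> (x + u))"
    by (rule sum.reindex_bij_betw[OF bij_plus_right, symmetric])
  also have "\<dots> = \<psi> u * (\<Sum>x\<in>UNIV. \<psi> x)"
    using add by (simp add: additive_character_def sum_distrib_left mult.commute)
  finally have *: "(\<Sum>x\<in>UNIV. \<psi> x) = 0" using u by simp
  have "(\<Sum>x\<in>UNIV. \<psi> (c * x)) = (\<Sum>x\<in>UNIV. \<psi> x)" if "c \<noteq> 0"
  proof (rule sum.reindex_bij_betw)
    show "bij ((*) c)"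
      by (rule bij_betw_byWitness[where f' = "\<lambda>x. x / c"]) (use that in auto)
  qed
  with * additive_character_zero[OF add] show ?thesis by simp
qed

section \<open>The quadratic Gauss sum\<close>

lemma sum_UNIV_squares:
  fixes h :: "'a::{field,finite} \<Rightarrow> 'b::comm_monoid_add"
  assumes "CARD('a) mod 4 = 3"
  shows "(\<Sum>x\<in>UNIV. h x) = h 0 + ((\<Sum>s\<in>nonzero_squares. h s) + (\<Sum>s\<in>nonzero_squares. h (- s)))"
proof -
  let ?S = "nonzero_squares :: 'a set"
  have zero: "0 \<notin> ?S" by (simp add: nonzero_squares_def)
  have neg: "x \<in> uminus ` ?S \<longleftrightarrow> - x \<in> ?S" for x
    using image_iff[of x uminus ?S] by (metis minus_minus)
  have disj: "?S \<inter> uminus ` ?S = {}"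
    using minus_square_iff[OF assms] neg zero by (metis disjoint_iff)
  have "UNIV = insert 0 (?S \<union> uminus ` ?S)"
    using minus_square_iff[OF assms] neg by blast
  moreover have "0 \<notin> ?S \<union> uminus ` ?S"
    using zero neg by simp
  ultimately have "(\<Sum>x\<in>UNIV. h x) = h 0 + (\<Sum>x\<in>?S \<union> uminus ` ?S. h x)"
    by (metis finite sum.insert)
  also have "(\<Sum>x\<in>?S \<union> uminus ` ?S. h x) = (\<Sum>x\<in>?S. h x) + (\<Sum>x\<in>uminus ` ?S. h x)"
    using disj by (simp add: sum.union_disjoint)
  also have "(\<Sum>x\<in>uminus ` ?S. h x) = (\<Sum>s\<in>?S. h (- s))"
    by (simp add: sum.reindex)
  finally show ?thesis .
qed

text \<open>Multiplication by a nonzero square is an injective self-map of the finite set of nonzero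
  squares, hence a permutation of it.\<close>

lemma sum_square_orbit:
  fixes h :: "'a::{field,finite} \<Rightarrow> 'b::comm_monoid_add"
  assumes "t \<in> nonzero_squares"
  shows "(\<Sum>s\<in>nonzero_squares. h (s * t)) = (\<Sum>s\<in>nonzero_squares. h s)"
proof (rule sum.reindex_bij_betw)
  have inj: "inj_on (\<lambda>s. s * t) nonzero_squares"
    using assms by (auto simp: inj_on_def nonzero_squares_def)
  moreover have "(\<lambda>s. s * t) ` nonzero_squares \<subseteq> nonzero_squares"
    using nonzero_squares_mult[OF _ assms] by blast
  ultimately show "bij_betw (\<lambda>s. s * t) nonzero_squares nonzero_squares"
    by (simp add: bij_betw_def endo_inj_surj)
qed

lemma quadratic_gauss_sum_cnj:
  "quadratic_gauss_sum (\<lambda>x. cnj (\<psi> x)) = cnj (quadratic_gauss_sum \<psi>)"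
  by (simp add: quadratic_gauss_sum_def)

lemma quadratic_gauss_sum_eq:
  fixes \<psi> :: "'a::{field,finite} \<Rightarrow> complex"
  assumes "CARD('a) mod 4 = 3" and "additive_character \<psi>"
  shows "quadratic_gauss_sum \<psi>
    = (\<Sum>s\<in>nonzero_squares. \<psi> s) - cnj (\<Sum>s\<in>nonzero_squares. \<psi> s)"
proof -
  have sq: "quadratic_character s = 1" "quadratic_character (- s) = - 1"
    if "s \<in> nonzero_squares" for s :: 'a
    using that quadratic_character_minus[OF assms(1), of s]
    by (auto simp: quadratic_character_eq nonzero_squares_def)
  have "quadratic_character (0 :: 'a) = 0" by (simp add: quadratic_character_def)
  then show ?thesis
    unfolding quadratic_gauss_sum_def sum_UNIV_squares[OF assms(1)]
    by (simp add: sq additive_character_minus[OF assms(2)] sum_negf)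
qed

text \<open>These are the quadratic Gaussian periods. By \<open>sum_square_orbit\<close> they depend
  only on whether \<open>x\<close> or \<open>- x\<close> is a square, so only \<open>?P\<close> and
  its conjugate occur.\<close>

lemma sum_squares_additive_character:
  fixes \<psi> :: "'a::{field,finite} \<Rightarrow> complex"
  assumes card: "CARD('a) mod 4 = 3" and \<psi>: "nontrivial_additive_character \<psi>" and "x \<noteq> 0"
  shows "(\<Sum>s\<in>nonzero_squares. \<psi> (s * x))
    = (of_int (quadratic_character x) * quadratic_gauss_sum \<psi> - 1) / 2"
proof -
  let ?P = "\<Sum>s\<in>nonzero_squares. \<psi> s"
  have add: "additive_character \<psi>" using \<psi> by (simp add: nontrivial_additive_character_def)
  have "(\<Sum>u\<in>UNIV. \<psi> u) = 1 + (?P + cnj ?P)"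
    unfolding sum_UNIV_squares[OF card]
    by (simp add: additive_character_minus[OF add] additive_character_zero[OF add])
  then have sum: "?P + cnj ?P = - 1"
    using sum_additive_character[OF \<psi>, of 1] by (simp add: add_eq_0_iff)
  have half: "p = (g - 1) / 2 \<and> c = (- g - 1) / 2" if "p + c = - 1" "g = p - c" for p c g :: complex
  proof -
    have "c = - 1 - p" using that(1) by (simp add: eq_diff_eq add.commute)
    with that(2) show ?thesis by simp
  qed
  have P: "?P = (quadratic_gauss_sum \<psi> - 1) / 2" "cnj ?P = (- quadratic_gauss_sum \<psi> - 1) / 2"
    using half[OF sum quadratic_gauss_sum_eq[OF card add]] by blast+
  show ?thesis
  proof (cases "x \<in> nonzero_squares")
    case True
    then have "(\<Sum>s\<in>nonzero_squares. \<psi> (s * x)) = ?P" by (rule sum_square_orbit)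
    with P True \<open>x \<noteq> 0\<close> show ?thesis by (simp add: quadratic_character_eq)
  next
    case False
    then have "- x \<in> nonzero_squares" using minus_square_iff[OF card \<open>x \<noteq> 0\<close>] by simp
    \<comment> \<open>The orbit argument applies to \<open>- x\<close>; conjugating turns the result
      into a statement about \<open>x\<close>.\<close>
    then have "(\<Sum>s\<in>nonzero_squares. \<psi> (s * - x)) = ?P" by (rule sum_square_orbit)
    then have "(\<Sum>s\<in>nonzero_squares. \<psi> (s * x)) = cnj ?P"
      by (simp add: additive_character_minus[OF add] del: cnj_sum)
         (metis (no_types, lifting) complex_cnj_cnj cnj_sum sum.cong)
    with P False \<open>x \<noteq> 0\<close> show ?thesis by (simp add: quadratic_character_eq del: cnj_sum)
  qed
qed

text \<open>Expand the product and sum over \<open>x\<close> first: orthogonality leaves only the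
  terms with \<open>s = t\<close>.\<close>

lemma parseval_additive_character:
  fixes \<psi> :: "'a::{field,finite} \<Rightarrow> complex"
  assumes "nontrivial_additive_character \<psi>"
  shows "(\<Sum>x\<in>UNIV. (\<Sum>s\<in>A. \<psi> (s * x)) * cnj (\<Sum>s\<in>A. \<psi> (s * x)))
    = of_nat CARD('a) * of_nat (card A)"
proof -
  have add: "additive_character \<psi>" using assms by (simp add: nontrivial_additive_character_def)
  have mult: "\<psi> (s * x) * cnj (\<psi> (t * x)) = \<psi> ((s - t) * x)" for s t x
    by (simp add: additive_character_mult_cnj[OF add] left_diff_distrib)
  have "(\<Sum>x\<in>UNIV. (\<Sum>s\<in>A. \<psi> (s * x)) * cnj (\<Sum>s\<in>A. \<psi> (s * x)))
      = (\<Sum>x\<in>UNIV. \<Sum>s\<in>A. \<Sum>t\<in>A. \<psi> ((s - t) * x))"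
    by (simp add: sum_product mult)
  also have "\<dots> = (\<Sum>s\<in>A. \<Sum>t\<in>A. \<Sum>x\<in>UNIV. \<psi> ((s - t) * x))"
    by (subst sum.swap, rule sum.cong[OF refl], rule sum.swap)
  also have "\<dots> = (\<Sum>s\<in>A. \<Sum>t\<in>A. if s = t then of_nat CARD('a) else 0)"
    by (simp add: sum_additive_character[OF assms])
  also have "\<dots> = of_nat CARD('a) * of_nat (card A)"
    by simp
  finally show ?thesis .
qed

text \<open>With n = (q - 1) / 2 nonzero squares, the squared modulus of \<open>F\<close> is n^2 at
  0 and c = (1 - g^2) / 4 at the other 2n points. Parseval gives n^2 + 2nc = qn, hence 2c = n + 1
  and g^2 = 1 - 4c = -q. The sign of g stays open.\<close>

lemma quadratic_gauss_sum_cases: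
  fixes \<psi> :: "'a::{field,finite} \<Rightarrow> complex"
  assumes card: "CARD('a) mod 4 = 3" and \<psi>: "nontrivial_additive_character \<psi>"
  shows "quadratic_gauss_sum \<psi> = \<i> * complex_of_real (sqrt (real CARD('a))) \<or>
    quadratic_gauss_sum \<psi> = - \<i> * complex_of_real (sqrt (real CARD('a)))"
proof -
  let ?S = "nonzero_squares :: 'a set" and ?g = "quadratic_gauss_sum \<psi>"
  define F where "F x = (\<Sum>s\<in>?S. \<psi> (s * x))" for x
  define n where "n = card ?S"
  have add: "additive_character \<psi>" using \<psi> by (simp add: nontrivial_additive_character_def)
  have odd: "odd CARD('a)" using card by presburger
  have q: "CARD('a) = 2 * n + 1" and n: "n \<noteq> 0"
    using card_nonzero_squares[OF odd] card unfolding n_def by presburger+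
  \<comment> \<open>Since g is purely imaginary, the squared moduli of \<open>F\<close> become
    polynomials in g itself.\<close>
  have cnj_g: "cnj ?g = - ?g"
    unfolding quadratic_gauss_sum_eq[OF card add] by simp
  have F: "F s * cnj (F s) = (1 - ?g\<^sup>2) / 4" "F (- s) * cnj (F (- s)) = (1 - ?g\<^sup>2) / 4"
    if "s \<in> ?S" for s
  proof -
    have "s \<noteq> 0" "quadratic_character s = 1" "quadratic_character (- s) = - 1"
      using that quadratic_character_minus[OF card, of s]
      by (auto simp: quadratic_character_eq nonzero_squares_def)
    then have Fs: "F s = (?g - 1) / 2" "F (- s) = (- ?g - 1) / 2"
      unfolding F_def
      using sum_squares_additive_character[OF card \<psi>, of s]
        sum_squares_additive_character[OF card \<psi>, of "- s"] by simp_all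
    show "F s * cnj (F s) = (1 - ?g\<^sup>2) / 4" "F (- s) * cnj (F (- s)) = (1 - ?g\<^sup>2) / 4"
      unfolding Fs by (simp_all add: cnj_g power2_eq_square field_simps)
  qed
  have F0: "F 0 = of_nat n"
    by (simp add: F_def n_def additive_character_zero[OF add])
  have "(\<Sum>x\<in>UNIV. F x * cnj (F x)) = of_nat CARD('a) * of_nat n"
    unfolding F_def n_def by (rule parseval_additive_character[OF \<psi>])
  moreover define c where "c = (1 - ?g\<^sup>2) / 4"
  have "(\<Sum>x\<in>UNIV. F x * cnj (F x)) = of_nat n * of_nat n + (of_nat n * c + of_nat n * c)"
    unfolding sum_UNIV_squares[OF card] by (simp add: F F0 n_def c_def)
  ultimately have "of_nat n * (of_nat n + 2 * c) = of_nat n * (of_nat CARD('a) :: complex)"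
    by (simp add: algebra_simps)
  then have "of_nat n + 2 * c = (of_nat CARD('a) :: complex)"
    using n by simp
  then have c: "2 * c = of_nat n + 1" by (simp add: q algebra_simps)
  have "?g\<^sup>2 = 1 - 2 * (2 * c)" by (simp add: c_def field_simps)
  also have "\<dots> = - of_nat CARD('a)" unfolding c by (simp add: q)
  also have "\<dots> = (\<i> * complex_of_real (sqrt (real CARD('a))))\<^sup>2"
    by (simp add: power_mult_distrib flip: of_real_power)
  finally show ?thesis by (simp add: power2_eq_iff)
qed

section \<open>Positive square roots of diagonal matrices\<close>

lemma mat_diag_mult_vec:
  "v \<in> carrier_vec n \<Longrightarrow> mat_diag n f *\<^sub>v v = vec n (\<lambda>i. f i * v $ i)"
  by (intro eq_vecI) (auto simp: mat_diag_def scalar_prod_def if_distrib[where f = "\<lambda>x. x * _"]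
      cong: if_cong)

lemma mat_adjoint_mat_diag: "mat_adjoint (mat_diag n f) = mat_diag n (\<lambda>i. conjugate (f i))"
  by (rule eq_matI) (auto simp: mat_adjoint_def mat_diag_def mat_of_rows_def cols_def)

lemma mat_diag_quadratic_form:
  assumes "v \<in> carrier_vec n"
  shows "Re ((mat_diag n (\<lambda>i. complex_of_real (r i)) *\<^sub>v v) \<bullet>c v) = (\<Sum>i<n. r i * (cmod (v $ i))\<^sup>2)"
  using assms
  by (simp add: mat_diag_mult_vec scalar_prod_def atLeast0LessThan mult.assoc
      complex_norm_square[symmetric] flip: of_real_mult of_real_power)

lemma positive_semidefinite_mat_diag:
  assumes "\<And>i. i < n \<Longrightarrow> 0 \<le> r i"
  shows "positive_semidefinite (mat_diag n (\<lambda>i. complex_of_real (r i)))"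
proof -
  have "dim_row (mat_diag n (\<lambda>i. complex_of_real (r i))) = n" by (simp add: mat_diag_def)
  then show ?thesis
    using assms
    by (auto simp: positive_semidefinite_def mat_adjoint_mat_diag mat_diag_quadratic_form
        intro!: sum_nonneg) (simp add: mat_diag_def)
qed

text \<open>The uniqueness that the definite description in \<open>positive_sqrt\<close> calls for;
  the diagonal case suffices because the frame operator will be diagonal.\<close>

lemma psd_square_root_mat_diag_unique:
  fixes r :: "nat \<Rightarrow> real"
  assumes r: "\<And>i. i < n \<Longrightarrow> 0 < r i"
    and R: "R \<in> carrier_mat n n" and psd: "positive_semidefinite R"
    and sq: "R * R = mat_diag n (\<lambda>i. complex_of_real ((r i)\<^sup>2))"
  shows "R = mat_diag n (\<lambda>i. complex_of_real (r i))"
proof -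
  let ?D = "mat_diag n (\<lambda>i. complex_of_real ((r i)\<^sup>2))"
  let ?E = "mat_diag n (\<lambda>i. complex_of_real (r i))"
  have E: "?E \<in> carrier_mat n n" by simp
  \<comment> \<open>\<open>R\<close> commutes with \<open>R\<^sup>2 = ?D\<close>, hence with \<open>?E\<close>, so that \<open>(R + ?E) (R - ?E) = 0\<close>;
    as \<open>R + ?E\<close> is positive definite, every column of \<open>R - ?E\<close> vanishes.\<close>
  have "?D * R = R * ?D"
    using assoc_mult_mat[OF R R R] by (simp add: sq)
  have comm: "?E * R = R * ?E"
  proof (rule eq_matI)
    fix i j assume "i < dim_row (R * ?E)" "j < dim_col (R * ?E)"
    then have ij: "i < n" "j < n" using R by (auto simp: mat_diag_def)
    have "(?D * R) $$ (i, j) = (R * ?D) $$ (i, j)" using \<open>?D * R = R * ?D\<close> by simp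
    then have "complex_of_real ((r i)\<^sup>2) * R $$ (i, j) = R $$ (i, j) * complex_of_real ((r j)\<^sup>2)"
      using ij by (simp add: mat_diag_mult_left[OF R] mat_diag_mult_right[OF R])
    \<comment> \<open>Where an entry of \<open>R\<close> is nonzero, the squares agree, and
      positivity of \<open>r\<close> makes the roots agree too; this is why \<open>R\<close>
      commutes with \<open>?E\<close>.\<close>
    then have "R $$ (i, j) = 0 \<or> (r i)\<^sup>2 = (r j)\<^sup>2"
      by (metis mult.commute mult_cancel_left of_real_eq_iff)
    then have "R $$ (i, j) = 0 \<or> r i = r j"
      using r[OF ij(1)] r[OF ij(2)] by (simp add: power2_eq_iff)
    then show "(?E * R) $$ (i, j) = (R * ?E) $$ (i, j)"
      using ij by (auto simp: mat_diag_mult_left[OF R] mat_diag_mult_right[OF R])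
  qed (use R in \<open>auto simp: mat_diag_def\<close>)
  let ?X = "R - ?E"
  have X: "?X \<in> carrier_mat n n" by (rule minus_carrier_mat[OF E])
  have "R * R = ?E * ?E" by (simp add: sq power2_eq_square)
  \<comment> \<open>\<open>R * R - R * ?E = ?E * ?E - ?E * R\<close>, by the equality of squares and
    commutation.\<close>
  then have RX: "R * ?X = - (?E * ?X)"
    using mult_minus_distrib_mat[OF R R E] mult_minus_distrib_mat[OF E R E] comm R
    by (intro eq_matI) (auto simp: mat_diag_def)
  have "col ?X j = 0\<^sub>v n" if j: "j < n" for j
  proof -
    define w where "w = col ?X j"
    have w: "w \<in> carrier_vec n" using X j unfolding w_def by (simp add: carrier_vecI)
    have "R *\<^sub>v w = col (R * ?X) j" unfolding w_def by (rule col_mult2[OF R X j, symmetric])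
    also have "\<dots> = - (?E *\<^sub>v w)"
      unfolding RX w_def col_mult2[OF E X j, symmetric]
      using R j by (intro eq_vecI) (auto simp: mat_diag_def)
    finally have "Re ((R *\<^sub>v w) \<bullet>c w) = - Re ((?E *\<^sub>v w) \<bullet>c w)"
      using w uminus_scalar_prod[of "?E *\<^sub>v w" n "conjugate w"]
        by (simp add: mat_diag_mult_vec)
    moreover have "0 \<le> Re ((R *\<^sub>v w) \<bullet>c w)"
      using psd R w by (simp add: positive_semidefinite_def)
    ultimately have "(\<Sum>i<n. r i * (cmod (w $ i))\<^sup>2) \<le> 0"
      by (simp add: mat_diag_quadratic_form[OF w])
    moreover have nonneg: "0 \<le> r i * (cmod (w $ i))\<^sup>2" if "i \<in> {..<n}" for i
      using r[of i] that by simp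
    ultimately have "(\<Sum>i<n. r i * (cmod (w $ i))\<^sup>2) = 0"
      using sum_nonneg[of "{..<n}" "\<lambda>i. r i * (cmod (w $ i))\<^sup>2"] by fastforce
    then have "r i * (cmod (w $ i))\<^sup>2 = 0" if "i < n" for i
      using sum_nonneg_eq_0_iff[OF finite_lessThan nonneg] that by auto
    then have "w $ i = 0" if "i < n" for i
      using r[OF that] that by fastforce
    then show ?thesis
      using w unfolding w_def[symmetric] by (intro eq_vecI) auto
  qed
  then have "?X $$ (i, j) = 0" if "i < n" "j < n" for i j
    using that X by (metis carrier_matD index_col index_zero_vec(1))
  then show ?thesis
    using R by (intro eq_matI) (auto simp: mat_diag_def)
qed

lemma inv_positive_sqrt_mat_diag:
  fixes r :: "nat \<Rightarrow> real"
  assumes r: "\<And>i. i < n \<Longrightarrow> 0 < r i"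
  shows "inv_positive_sqrt (mat_diag n (\<lambda>i. complex_of_real ((r i)\<^sup>2)))
    = mat_diag n (\<lambda>i. complex_of_real (1 / r i))"
proof -
  let ?E = "mat_diag n (\<lambda>i. complex_of_real (r i))"
  let ?F = "mat_diag n (\<lambda>i. complex_of_real (1 / r i))"
  have E: "?E \<in> carrier_mat n n" and F: "?F \<in> carrier_mat n n" by simp_all
  have sqrt: "positive_sqrt (mat_diag n (\<lambda>i. complex_of_real ((r i)\<^sup>2))) = ?E"
    unfolding positive_sqrt_def
  proof (rule the_equality, goal_cases)
    case 1
    show ?case
      using r positive_semidefinite_mat_diag[of n r]
      by (auto simp: less_imp_le power2_eq_square) (simp_all add: mat_diag_def)
  next
    case (2 R)
    have dim: "dim_row (mat_diag n (\<lambda>i. complex_of_real ((r i)\<^sup>2))) = n"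
      by (simp add: mat_diag_def)
    from 2[unfolded dim] have "R \<in> carrier_mat n n" "positive_semidefinite R"
      "R * R = mat_diag n (\<lambda>i. complex_of_real ((r i)\<^sup>2))" by blast+
    with r show ?case by (rule psd_square_root_mat_diag_unique)
  qed
  have "r i \<noteq> 0" if "i < n" for i using r[OF that] by simp
  then have inv: "?E * ?F = 1\<^sub>m n" "?F * ?E = 1\<^sub>m n"
    unfolding mat_diag_diag by (auto simp: mat_diag_def intro!: eq_matI)
  show ?thesis
  \<comment> \<open>\<open>inv_positive_sqrt\<close> applies \<open>the\<close> to an option, so
    \<open>None\<close> has to be excluded: \<open>?F\<close> witnesses that \<open>?E\<close> is a
    unit.\<close>
  proof (cases "mat_inverse ?E")
    case None
    then have "?E \<notin> Units (ring_mat TYPE(complex) n ())" 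
      by (rule mat_inverse(1)[OF E])
    moreover have "?E \<in> Units (ring_mat TYPE(complex) n ())"
      unfolding Units_def ring_mat_def using E F inv by (auto simp del: mat_diag_diag)
    ultimately show ?thesis by blast
  next
    case (Some B)
    from mat_inverse(2)[OF E Some] have B: "?E * B = 1\<^sub>m n" "B \<in> carrier_mat n n" by auto
    have "B = ?F * ?E * B" unfolding inv using B by simp
    also have "\<dots> = ?F" unfolding assoc_mult_mat[OF F E B(2)] B(1) by (rule right_mult_one_mat[OF F])
    finally show ?thesis unfolding inv_positive_sqrt_def sqrt Some option.sel .
  qed
qed

section \<open>The truncated Zauner frame\<close>

text \<open>Frequency \<open>0\<close> makes the constant first row of \<open>T\<close> an instance of the pattern of the others,
  as \<open>\<psi> 0 = 1\<close>.\<close>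

definition zauner_freq :: "(nat \<Rightarrow> 'a::field) \<Rightarrow> nat \<Rightarrow> 'a" where
  "zauner_freq b = case_nat 0 b"

text \<open>The row scalings of Zauner's matrix; they turn out to be the square roots of the
  eigenvalues of the frame operator.\<close>

definition zauner_weight :: "nat \<Rightarrow> real" where
  "zauner_weight = case_nat 1 (\<lambda>_. sqrt 2)"

lemma zauner_weight_pos: "0 < zauner_weight r"
  by (simp add: zauner_weight_def split: nat.split)

text \<open>Weights and frequencies merge both kinds of rows into one formula. Column
  \<open>k + 1\<close> carries \<open>a k\<close> because column 0 is the removed one.\<close>

lemma truncated_zauner_eq:
  assumes "additive_character \<psi>" and "k < q"
  shows "truncated_zauner q \<psi> a b k = vec ((q + 1) div 2)
    (\<lambda>r. complex_of_real (zauner_weight r / sqrt (real q)) * \<psi> (zauner_freq b r * a k))"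
  using assms additive_character_zero[OF assms(1)]
  by (intro eq_vecI)
     (auto simp: truncated_zauner_def zauner_mat_def zauner_weight_def zauner_freq_def split: nat.split)

text \<open>Frequency 0 is not a nonzero square, so distinct rows have distinct frequencies, and
  sums over rows become sums over field elements.\<close>

lemma bij_betw_zauner_freq:
  assumes "bij_betw b {..<n} nonzero_squares"
  shows "bij_betw (zauner_freq b) {..<Suc n} (insert 0 nonzero_squares)"
proof -
  have "inj_on (zauner_freq b) {..<Suc n}"
    using assms
    by (auto simp: bij_betw_def inj_on_def zauner_freq_def nonzero_squares_def image_def split: nat.splits)
  moreover have "zauner_freq b ` {..<Suc n} = insert 0 nonzero_squares"
    using assms by (simp add: lessThan_Suc_eq_insert_0 image_image zauner_freq_def bij_betw_def)
  ultimately show ?thesis by (simp add: bij_betw_def)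
qed

text \<open>Entry (r, s) is a full character sum at the difference of two frequencies: it vanishes
  off the diagonal, and on the diagonal its value q cancels the normalization of the matrix.\<close>

lemma frame_operator_truncated_zauner:
  fixes \<psi> :: "'a::{field,finite} \<Rightarrow> complex"
  assumes q: "q = CARD('a)" "q + 1 = 2 * d" and \<psi>: "nontrivial_additive_character \<psi>"
    and a: "bij_betw a {..<q} UNIV"
    and b: "bij_betw b {..<(q - 1) div 2} nonzero_squares"
  shows "frame_operator q d (truncated_zauner q \<psi> a b)
    = mat_diag d (\<lambda>r. complex_of_real ((zauner_weight r)\<^sup>2))"
proof (rule eq_matI)
  have add: "additive_character \<psi>" using \<psi> by (simp add: nontrivial_additive_character_def)
  fix r s
  assume "r < dim_row (mat_diag d (\<lambda>r. complex_of_real ((zauner_weight r)\<^sup>2)))"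
    and "s < dim_col (mat_diag d (\<lambda>r. complex_of_real ((zauner_weight r)\<^sup>2)))"
  then have rs: "r < d" "s < d" by (auto simp: mat_diag_def)
  have d: "d = Suc ((q - 1) div 2)" using q(2) by presburger
  have inj: "zauner_freq b r = zauner_freq b s \<longleftrightarrow> r = s"
    using bij_betw_zauner_freq[OF b] rs unfolding d[symmetric] bij_betw_def
    by (auto simp: inj_on_eq_iff)
  let ?c = "complex_of_real (zauner_weight r * zauner_weight s / real q)"
  have "frame_operator q d (truncated_zauner q \<psi> a b) $$ (r, s)
      = (\<Sum>j<q. ?c * \<psi> ((zauner_freq b r - zauner_freq b s) * a j))"
    using rs q(2)
    by (auto simp: frame_operator_def truncated_zauner_eq[OF add] left_diff_distrib
        additive_character_mult_cnj[OF add, symmetric] field_simps simp flip: of_real_mult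
        intro!: sum.cong)
  also have "\<dots> = ?c * (\<Sum>x\<in>UNIV. \<psi> ((zauner_freq b r - zauner_freq b s) * x))"
    unfolding sum_distrib_left by (rule sum.reindex_bij_betw[OF a])
  also have "\<dots> = mat_diag d (\<lambda>r. complex_of_real ((zauner_weight r)\<^sup>2)) $$ (r, s)"
    using rs by (simp add: sum_additive_character[OF \<psi>] inj mat_diag_def q(1) power2_eq_square)
  finally show "frame_operator q d (truncated_zauner q \<psi> a b) $$ (r, s)
      = mat_diag d (\<lambda>r. complex_of_real ((zauner_weight r)\<^sup>2)) $$ (r, s)" .
qed (auto simp: frame_operator_def mat_diag_def)

text \<open>The inverse square root of the frame operator divides row r by its weight, and the
  factor \<open>sqrt (real q / real d)\<close> replaces 1 / sqrt q by 1 / sqrt d.\<close>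

lemma normalized_canonical_zauner_eq:
  fixes \<psi> :: "'a::{field,finite} \<Rightarrow> complex"
  assumes q: "q = CARD('a)" "q + 1 = 2 * d" and \<psi>: "nontrivial_additive_character \<psi>"
    and a: "bij_betw a {..<q} UNIV"
    and b: "bij_betw b {..<(q - 1) div 2} nonzero_squares"
    and k: "k < q"
  shows "normalized_canonical_zauner q d \<psi> a b k
    = vec d (\<lambda>r. complex_of_real (1 / sqrt (real d)) * \<psi> (zauner_freq b r * a k))"
proof -
  have add: "additive_character \<psi>" using \<psi> by (simp add: nontrivial_additive_character_def)
  have d: "(q + 1) div 2 = d" using q(2) by simp
  have "zauner_weight r \<noteq> 0" for r
    using zauner_weight_pos[of r] by simp
  with k show ?thesis
    unfolding normalized_canonical_zauner_def canonical_tight_frame_def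
      frame_operator_truncated_zauner[OF q \<psi> a b]
      inv_positive_sqrt_mat_diag[of d zauner_weight, OF zauner_weight_pos]
      truncated_zauner_eq[OF add k] d
    by (intro eq_vecI)
       (simp_all add: mat_diag_mult_vec real_sqrt_divide)
qed

text \<open>For \<open>j \<noteq> k\<close> the row sum is 1 plus a Gaussian period at
  \<open>a k - a j\<close>; the minus sign comes from oddness of the quadratic character. For
  \<open>j = k\<close> it is 1 + (q - 1) / 2.\<close>

lemma normalized_canonical_zauner_inner:
  fixes \<psi> :: "'a::{field,finite} \<Rightarrow> complex"
  assumes q: "q = CARD('a)" "q + 1 = 2 * d" "q mod 4 = 3"
    and \<psi>: "nontrivial_additive_character \<psi>"
    and a: "bij_betw a {..<q} UNIV"
    and b: "bij_betw b {..<(q - 1) div 2} nonzero_squares"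
    and jk: "j < q" "k < q"
  shows "normalized_canonical_zauner q d \<psi> a b k \<bullet>c normalized_canonical_zauner q d \<psi> a b j
    = (1 + (if j = k then of_nat q else 0)
        - of_int (quadratic_character (a j - a k)) * quadratic_gauss_sum \<psi>) / (2 * of_nat d)"
proof -
  have add: "additive_character \<psi>" using \<psi> by (simp add: nontrivial_additive_character_def)
  have card: "CARD('a) mod 4 = 3" using q by simp
  have d: "d = Suc ((q - 1) div 2)" using q(2) by presburger
  let ?x = "a k - a j"
  have "normalized_canonical_zauner q d \<psi> a b k \<bullet>c normalized_canonical_zauner q d \<psi> a b j
      = (\<Sum>r<d. \<psi> (zauner_freq b r * ?x) / of_nat d)"
    unfolding normalized_canonical_zauner_eq[OF q(1,2) \<psi> a b jk(1)]
      normalized_canonical_zauner_eq[OF q(1,2) \<psi> a b jk(2)]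
    by (simp add: scalar_prod_def atLeast0LessThan right_diff_distrib
        additive_character_mult_cnj[OF add, symmetric] flip: of_real_mult)
  also have "\<dots> = (\<Sum>r<d. \<psi> (zauner_freq b r * ?x)) / of_nat d"
    by (rule sum_divide_distrib[symmetric])
  also have "(\<Sum>r<d. \<psi> (zauner_freq b r * ?x)) = (\<Sum>s\<in>insert 0 nonzero_squares. \<psi> (s * ?x))"
    unfolding d by (rule sum.reindex_bij_betw[OF bij_betw_zauner_freq[OF b]])
  also have "\<dots> = 1 + (\<Sum>s\<in>nonzero_squares. \<psi> (s * ?x))"
    by (simp add: nonzero_squares_def additive_character_zero[OF add])
  also have "\<dots> = (1 + (if j = k then of_nat q else 0)
        - of_int (quadratic_character (a j - a k)) * quadratic_gauss_sum \<psi>) / 2"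
  proof (cases "j = k")
    case True
    have "odd CARD('a)" using card by presburger
    then have "q = 2 * card (nonzero_squares :: 'a set) + 1"
      using card_nonzero_squares[where 'a = 'a] q by presburger
    with True show ?thesis
      by (simp add: additive_character_zero[OF add] quadratic_character_def)
  next
    case False
    with a jk have "?x \<noteq> 0" by (auto simp: bij_betw_def inj_on_eq_iff)
    have "quadratic_character (a j - a k) = - quadratic_character ?x"
      using quadratic_character_minus[OF card, of ?x] by simp
    then show ?thesis
      using False unfolding sum_squares_additive_character[OF card \<psi> \<open>?x \<noteq> 0\<close>]
      by (simp add: field_simps)
  qed
  finally show ?thesis by simp
qed

section \<open>Equiangularity and the Gram matrix\<close>

lemma normalized_canonical_zauner_etf:
  fixes \<psi> :: "'a::{field,finite} \<Rightarrow> complex"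
  assumes q: "q = CARD('a)" "q + 1 = 2 * d" "q mod 4 = 3"
    and \<psi>: "nontrivial_additive_character \<psi>"
    and a: "bij_betw a {..<q} UNIV"
    and b: "bij_betw b {..<(q - 1) div 2} nonzero_squares"
  shows "equiangular_tight_frame q d (normalized_canonical_zauner q d \<psi> a b)"
proof -
  let ?\<phi> = "normalized_canonical_zauner q d \<psi> a b"
  note inner = normalized_canonical_zauner_inner[OF q \<psi> a b]
  have card: "CARD('a) mod 4 = 3" using q by simp
  \<comment> \<open>Needed below to cancel \<open>real d - 1\<close>.\<close>
  have d: "2 \<le> d" using q by presburger
  have "?\<phi> k \<in> carrier_vec d" if "k < q" for k
    by (simp add: normalized_canonical_zauner_eq[OF q(1,2) \<psi> a b that])
  moreover have "?\<phi> k \<bullet>c ?\<phi> k = 1" if "k < q" for k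
  proof -
    have "1 + of_nat q = 2 * complex_of_nat d" using q(2) by (metis of_nat_1 of_nat_add of_nat_mult of_nat_numeral add.commute)
    with d show ?thesis by (simp add: inner[OF that that] quadratic_character_def)
  qed
  moreover have "(cmod (?\<phi> k \<bullet>c ?\<phi> j))\<^sup>2 = (real q - real d) / (real d * (real q - 1))"
    if "j < q" "k < q" "j \<noteq> k" for j k
  proof -
    have "a j - a k \<noteq> 0" using a that by (auto simp: bij_betw_def inj_on_eq_iff)
    then have "quadratic_character (a j - a k) = 1 \<or> quadratic_character (a j - a k) = - 1"
      by (simp add: quadratic_character_def)
    \<comment> \<open>The signs of the character and of the Gauss sum affect only the sign of the
      imaginary part, so the modulus is the same for all pairs.\<close>
    then have "?\<phi> k \<bullet>c ?\<phi> j = Complex 1 (sqrt (real q)) / of_real (2 * real d) \<or>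
        ?\<phi> k \<bullet>c ?\<phi> j = Complex 1 (- sqrt (real q)) / of_real (2 * real d)"
      using quadratic_gauss_sum_cases[OF card \<psi>] that(3)
      by (auto simp: inner[OF that(1,2)] q(1)[symmetric] complex_eq_iff)
    then have cmod: "(cmod (?\<phi> k \<bullet>c ?\<phi> j))\<^sup>2 = (1 + real q) / (2 * real d)\<^sup>2"
      by (auto simp: norm_divide power_divide cmod_power2 add_divide_distrib)
    have rq: "real q = 2 * real d - 1" using q(2) by linarith
    note cmod
    also have "(1 + real q) / (2 * real d)\<^sup>2 = 1 / (2 * real d)"
      unfolding rq using d by (simp add: power2_eq_square)
    also have "\<dots> = (real d - 1) / (real d * (2 * (real d - 1)))"
      using d by (simp add: field_simps)
    also have "\<dots> = (real q - real d) / (real d * (real q - 1))"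
      unfolding rq by (simp add: algebra_simps)
    finally show ?thesis .
  qed
  ultimately show ?thesis by (simp add: equiangular_tight_frame_def)
qed

lemma gram_mat_normalized_canonical_zauner:
  fixes \<psi> :: "'a::{field,finite} \<Rightarrow> complex"
  assumes q: "q = CARD('a)" "q + 1 = 2 * d" "q mod 4 = 3"
    and \<psi>: "nontrivial_additive_character \<psi>"
    and a: "bij_betw a {..<q} UNIV"
    and b: "bij_betw b {..<(q - 1) div 2} nonzero_squares"
  shows "quadratic_gauss_sum \<psi> = - \<i> * complex_of_real (sqrt (real q)) \<Longrightarrow>
      gram_mat q (normalized_canonical_zauner q d \<psi> a b) = paley_gram q d (paley_tournament_mat q a)"
    and "quadratic_gauss_sum \<psi> = \<i> * complex_of_real (sqrt (real q)) \<Longrightarrow>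
      gram_mat q (normalized_canonical_zauner q d \<psi> a b) = paley_gram q d (- paley_tournament_mat q a)"
proof -
  note entry = normalized_canonical_zauner_inner[OF q \<psi> a b]
  have zero: "quadratic_character (0 :: 'a) = 0" by (simp add: quadratic_character_def)
  show "gram_mat q (normalized_canonical_zauner q d \<psi> a b) = paley_gram q d (paley_tournament_mat q a)"
    if "quadratic_gauss_sum \<psi> = - \<i> * complex_of_real (sqrt (real q))"
    by (rule eq_matI)
       (simp_all add: gram_mat_def paley_gram_def paley_tournament_mat_def entry that zero mult_ac)
  show "gram_mat q (normalized_canonical_zauner q d \<psi> a b) = paley_gram q d (- paley_tournament_mat q a)"
    if "quadratic_gauss_sum \<psi> = \<i> * complex_of_real (sqrt (real q))"
    by (rule eq_matI)
       (simp_all add: gram_mat_def paley_gram_def paley_tournament_mat_def entry that zero mult_ac)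
qed

text \<open>The orientation of the tournament follows the sign of the Gauss sum. Conjugating
  \<open>\<psi>\<close> flips that sign, so one of the two characters always gives the prescribed
  Gram matrix, while equiangularity holds for either sign.\<close>

theorem theorem3:
  fixes \<psi> :: "'a::{field,finite} \<Rightarrow> complex"
    and a b :: "nat \<Rightarrow> 'a"
    and p m q d :: nat
  assumes "prime p" and "q = p ^ m" and "q = 2 * d - 1" and "q mod 4 = 3"
    and "card (UNIV :: 'a set) = q"
    and "nontrivial_additive_character \<psi>"
    and "bij_betw a {..<q} UNIV"
    and "bij_betw b {..<(q - 1) div 2} nonzero_squares"
  shows
    "(\<exists>\<psi>' \<in> {\<psi>, \<lambda>x. cnj (\<psi> x)}.
        nontrivial_additive_character \<psi>' \<and>
        equiangular_tight_frame q d (normalized_canonical_zauner q d \<psi>' a b) \<and>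
        gram_mat q (normalized_canonical_zauner q d \<psi>' a b)
          = paley_gram q d (paley_tournament_mat q a)) \<and>
     equiangular_tight_frame q d (normalized_canonical_zauner q d \<psi> a b) \<and>
     (quadratic_gauss_sum \<psi> = - \<i> * complex_of_real (sqrt (real q)) \<and>
        gram_mat q (normalized_canonical_zauner q d \<psi> a b)
          = paley_gram q d (paley_tournament_mat q a) \<or>
      quadratic_gauss_sum \<psi> = \<i> * complex_of_real (sqrt (real q)) \<and>
        gram_mat q (normalized_canonical_zauner q d \<psi> a b)
          = paley_gram q d (- paley_tournament_mat q a))"
proof -
  have card: "q = CARD('a)" using assms(5) by simp
  \<comment> \<open>Truncated subtraction is harmless: \<open>d = 0\<close> would give
    \<open>q = 0\<close>, against \<open>q mod 4 = 3\<close>.\<close>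
  have d: "q + 1 = 2 * d" using assms(3,4) by (cases d) auto
  note hyps = card d assms(4)
  have cnj: "nontrivial_additive_character (\<lambda>x. cnj (\<psi> x))"
    using assms(6) by (simp add: nontrivial_additive_character_def additive_character_def)
  note etf = normalized_canonical_zauner_etf[OF hyps _ assms(7,8)]
  note gram = gram_mat_normalized_canonical_zauner[OF hyps _ assms(7,8)]
  have "quadratic_gauss_sum \<psi> = \<i> * complex_of_real (sqrt (real q)) \<or>
      quadratic_gauss_sum \<psi> = - \<i> * complex_of_real (sqrt (real q))"
    using quadratic_gauss_sum_cases[OF _ assms(6)] assms(4,5) by simp
  then show ?thesis
  proof
    assume g: "quadratic_gauss_sum \<psi> = \<i> * complex_of_real (sqrt (real q))"
    then have "quadratic_gauss_sum (\<lambda>x. cnj (\<psi> x)) = - \<i> * complex_of_real (sqrt (real q))"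
      by (simp add: quadratic_gauss_sum_cnj)
    then show ?thesis
      using g etf[OF assms(6)] etf[OF cnj] gram(1)[OF cnj] gram(2)[OF assms(6) g] cnj by blast
  next
    assume g: "quadratic_gauss_sum \<psi> = - \<i> * complex_of_real (sqrt (real q))"
    then show ?thesis
      using etf[OF assms(6)] gram(1)[OF assms(6) g] assms(6) by blast
  qed
qed

end
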